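(* Let $m,t$ be integers with $m>0$ and $0\le t\le m$, and let $g=\gcd(t,m)$. Then, as a function of $n\in\mathbb{Z}/m\mathbb{Z}$, $Q_{m,t}(n)$ attains its maximum value precisely at those $n$ satisfying: (1) $\gcd(n,t,m)=g$, if $g$ is odd; or (2) $\gcd(n,t,m)=g$, if $g$ is even and $v_2(g)<v_2(t)$; or (3) $\gcd(n,t,m)=g/2$, if $g$ is even and $v_2(g)=v_2(t)$.
   Context: $Q_{m,t}(n)$ is the number of $t$-element subsets of $\mathbb{Z}/m\mathbb{Z}$ whose elements sum to $n$ in $\mathbb{Z}/m\mathbb{Z}$. $\gcd(n,t,m)$ is well defined for a residue $n$ modulo $m$ (it does not depend on the representative); $\gcd(0,m)=m$. $v_2$ denotes the 2-adic valuation, with $v_2(0)=+\infty$. *)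

theory Defs
  imports Complex_Main "HOL-Number_Theory.Cong" "HOL-Computational_Algebra.Primes" "HOL-Library.Extended_Nat"
begin

text \<open>
  The ring of integers modulo \<open>m\<close> is represented by the integers \<open>0, \<dots>, m - 1\<close>, so that the
  \<open>t\<close>-element subsets are sets of such integers. The target residue \<open>n\<close> may be given by an
  arbitrary integer representative; see \<open>Q_cong\<close>.
\<close>

definition Q :: "nat \<Rightarrow> nat \<Rightarrow> int \<Rightarrow> nat" where
  "Q m t n = card {A. A \<subseteq> {0..<int m} \<and> card A = t \<and> [(\<Sum>a\<in>A. a) = n] (mod int m)}"

lemma Q_cong: "[n = n'] (mod int m) \<Longrightarrow> Q m t n = Q m t n'"
  unfolding Q_def by (metis (no_types, lifting) cong_sym cong_trans)

text \<open>The library's \<^const>\<open>multiplicity\<close> is \<open>0\<close> at \<open>0\<close>, whereas here the value is infinite.\<close>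

definition v2 :: "nat \<Rightarrow> enat" where
  "v2 k = (if k = 0 then \<infinity> else enat (multiplicity 2 k))"

end

theory Submission
  imports Defs "HOL-Computational_Algebra.Polynomial" "HOL-Library.FuncSet"
begin

text \<open>
  For a \<open>t\<close>-subset \<open>A\<close> of \<open>\<int>/m\<close> let \<open>e(A)\<close> be the order of its stabiliser under translation; it
  divides \<open>g = gcd(t, m)\<close>, and some \<open>A\<close> attains \<open>e(A) = g\<close>. For a character \<open>\<chi>\<^sub>k\<close> of order \<open>d\<close>, the
  sum of \<open>\<chi>\<^sub>k(\<Sum>A)\<close> over all \<open>A\<close> is the coefficient of \<open>X\<close> to the \<open>t\<close> in
  \<open>\<Prod>(1 + \<chi>\<^sub>k(a) X)\<close>, a power of \<open>1 - (-X)\<close> to the \<open>d\<close>; up to the sign \<open>(-1)\<close> to the \<open>t + t/d\<close> it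
  counts the \<open>A\<close> with \<open>A + k = A\<close>. Fourier inversion, with the sum over \<open>k\<close> taken inside the sum
  over \<open>A\<close>, then gives
  \<open>m Q(n) = (\<Sum>A. e(A) [n \<equiv> \<delta>(e(A)) mod e(A)])\<close>,
  where the sign contributes \<open>\<delta>(e) = e/2\<close> if \<open>e\<close> is even and \<open>t/e\<close> odd, and \<open>\<delta>(e) = 0\<close> otherwise.
  As \<open>\<delta>(g) \<equiv> \<delta>(e) mod e\<close> for \<open>e\<close> dividing \<open>g\<close>, all these congruences hold at once exactly when
  \<open>n \<equiv> \<delta>(g) mod g\<close>, so this condition describes the maximum.
\<close>

section \<open>Characters of Z/m and their orthogonality\<close>

text \<open>Only the basic character is named; the character with index \<open>k\<close> is
  \<open>root_char m (int k * x)\<close>.\<close>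

definition root_char :: "nat \<Rightarrow> int \<Rightarrow> complex" where
  "root_char m x = cis (2 * pi * of_int x / of_nat m)"

lemma root_char_0 [simp]: "root_char m 0 = 1"
  by (simp add: root_char_def)

lemma root_char_add: "root_char m (x + y) = root_char m x * root_char m y"
  by (simp add: root_char_def cis_mult add_divide_distrib ring_distribs)

lemma root_char_sum: "root_char m (sum f A) = (\<Prod>a\<in>A. root_char m (f a))"
  by (induction A rule: infinite_finite_induct) (simp_all add: root_char_add)

lemma root_char_power: "root_char m x ^ k = root_char m (int k * x)"
  by (simp add: root_char_def DeMoivre mult_ac)

lemma root_char_eq_1_iff:
  assumes "m > 0"
  shows "root_char m x = 1 \<longleftrightarrow> int m dvd x"
proof
  assume "root_char m x = 1"
  then have "cos (2 * pi * of_int x / of_nat m) = 1"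
    by (simp add: root_char_def complex_eq_iff)
  then obtain k :: int where "2 * pi * of_int x / of_nat m = of_int k * 2 * pi"
    by (auto simp: cos_one_2pi_int)
  then have "real_of_int x = of_int k * of_nat m"
    using assms by (simp add: field_simps)
  then have "x = k * int m"
    by (metis of_int_eq_iff of_int_mult of_int_of_nat_eq)
  then show "int m dvd x" by simp
next
  assume "int m dvd x"
  then obtain k where "x = int m * k" ..
  then have "2 * pi * of_int x / of_nat m = 2 * pi * of_int k"
    using assms by simp
  then have "root_char m x = cis (2 * pi * of_int k)"
    by (simp only: root_char_def)
  then show "root_char m x = 1" by (metis Ints_of_int cis_multiple_2pi)
qed

lemma root_char_cancel: "p > 0 \<Longrightarrow> root_char (p * e) (int p * x) = root_char e x"
  by (simp add: root_char_def mult.assoc)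

lemma root_char_half: "root_char (2 * h) (int h) = (if h = 0 then 1 else -1)"
  by (simp add: root_char_def)

lemma sum_root_char:
  assumes "m > 0"
  shows "(\<Sum>k<m. root_char m (int k * x)) = (if int m dvd x then of_nat m else 0)"
proof (cases "int m dvd x")
  case True
  then have "root_char m (int k * x) = 1" for k
    using assms by (simp add: root_char_eq_1_iff)
  with True show ?thesis by simp
next
  case False
  have "root_char m x \<noteq> 1" "root_char m x ^ m = 1"
    using False assms by (simp_all add: root_char_power root_char_eq_1_iff)
  \<comment> \<open>A geometric sum whose ratio is an \<open>m\<close>-th root of unity other than
    1.\<close>
  then have "(\<Sum>k<m. root_char m x ^ k) = 0"
    by (simp add: geometric_sum)
  with False show ?thesis by (simp add: root_char_power)
qed

section \<open>Generating polynomials of subsets\<close>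

text \<open>The hypothesis makes \<open>z\<close> a primitive \<open>d\<close>-th root of unity.
  Both sides have degree at most \<open>d\<close>, take the value 1 at 0, and vanish at the
  \<open>d\<close> distinct points \<open>- (z ^ b)\<close>; agreement at \<open>d + 1\<close>
  points forces equality.\<close>

lemma prod_linear_roots_of_unity:
  fixes z :: complex
  assumes d: "d > 0" and z: "\<And>j. z ^ j = 1 \<longleftrightarrow> d dvd j"
  shows "(\<Prod>a<d. [:1, z ^ a:]) = 1 - [:0, -1:] ^ d"
proof (rule poly_eqI_degree)
  let ?R = "insert 0 ((\<lambda>a. - (z ^ a)) ` {..<d})"
  have z0: "z \<noteq> 0" using z[of d] d by (auto simp: power_0_left)
  have zd: "z ^ d = 1" using z by simp
  have "inj_on (\<lambda>a. - (z ^ a)) {..<d}"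
  proof (rule inj_onI)
    have *: "a = b" if "a \<le> b" "b < d" "z ^ a = z ^ b" for a b
    proof -
      have "z ^ b = z ^ a * z ^ (b - a)" using that by (metis le_add_diff_inverse power_add)
      then have "z ^ (b - a) = 1" using that z0 by simp
      then have "d dvd b - a" using z by simp
      then show ?thesis using that by (metis dvd_imp_le diff_is_0_eq le_antisym less_imp_diff_less linorder_not_le not_gr_zero)
    qed
    fix a b assume "a \<in> {..<d}" "b \<in> {..<d}" "- (z ^ a) = - (z ^ b)"
    then show "a = b" using *[of a b] *[of b a] by (cases "a \<le> b") auto
  qed
  then have card: "card ?R = Suc d"
    using z0 by (subst card_insert_disjoint) (auto simp: card_image)
  have "degree (\<Prod>a<d. [:1, z ^ a:]) \<le> (\<Sum>a<d. degree [:1, z ^ a:])"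
    using degree_prod_sum_le[of "{..<d}" "\<lambda>a. [:1, z ^ a:]"] by (simp add: o_def)
  also have "\<dots> \<le> (\<Sum>a<d. 1)" by (rule sum_mono) simp
  finally show "degree (\<Prod>a<d. [:1, z ^ a:]) < card ?R" using card by simp
  have "degree (1 - [:0, -1::complex:] ^ d) \<le> d"
    by (intro degree_diff_le) (use degree_power_le[of "[:0, -1::complex:]" d] in auto)
  then show "degree (1 - [:0, -1::complex:] ^ d) < card ?R" using card by simp
  fix x assume "x \<in> ?R"
  then consider "x = 0" | b where "b < d" "x = - (z ^ b)" by auto
  then show "poly (\<Prod>a<d. [:1, z ^ a:]) x = poly (1 - [:0, -1:] ^ d) x"
  proof cases
    case 1
    then show ?thesis using d by (simp add: poly_prod)
  next
    case 2
    \<comment> \<open>The factor with index \<open>-b\<close> modulo \<open>d\<close> vanishes at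
      \<open>x\<close>. The reduction matters for \<open>b = 0\<close>, where \<open>d - b\<close>
      would fall outside the range of the product.\<close>
    define a where "a = (d - b) mod d"
    have "z ^ (b + a) = 1"
      using 2 by (subst z) (simp add: a_def dvd_eq_mod_eq_0 mod_add_right_eq)
    then have "\<exists>a\<in>{..<d}. 1 + x * z ^ a = 0"
      using 2 d by (intro bexI[of _ a]) (auto simp: a_def power_add)
    moreover have "(z ^ b) ^ d = 1" using zd by (metis mult.commute power_mult power_one)
    ultimately show ?thesis using 2 by (auto simp: poly_prod)
  qed
qed

text \<open>Expanding the product, \<open>A\<close> collects the factors that contribute their
  linear term, so the coefficient is an elementary symmetric polynomial.\<close>

lemma coeff_prod_linear:
  assumes "finite S"
  shows "coeff (\<Prod>a\<in>S. [:1, f a:]) t = (\<Sum>A | A \<subseteq> S \<and> card A = t. \<Prod>a\<in>A. (f a :: 'a :: comm_ring_1))"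
proof -
  have mon: "(\<Prod>a\<in>A. monom (f a) 1) = monom (\<Prod>a\<in>A. f a) (card A)" if "finite A" for A
    using that by induction (auto simp: mult_monom)
  have "(\<Prod>a\<in>S. [:1, f a:]) = (\<Prod>a\<in>S. monom (f a) 1 + 1)"
    by (rule prod.cong) (simp_all add: monom_Suc monom_0 one_pCons flip: numeral_One)
  also have "\<dots> = (\<Sum>A\<in>Pow S. \<Prod>a\<in>A. monom (f a) 1)"
    by (subst prod_add) (use assms in simp_all)
  also have "\<dots> = (\<Sum>A\<in>Pow S. monom (\<Prod>a\<in>A. f a) (card A))"
    using assms by (intro sum.cong mon) (auto intro: finite_subset)
  also have "coeff \<dots> t = (\<Sum>A\<in>Pow S. if card A = t then \<Prod>a\<in>A. f a else 0)"
    by (simp add: coeff_sum)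
  also have "\<dots> = (\<Sum>A | A \<subseteq> S \<and> card A = t. \<Prod>a\<in>A. f a)"
    using assms by (intro sum.mono_neutral_cong_right) auto
  finally show ?thesis .
qed

lemma coeff_binomial_signed:
  assumes "d > 0"
  shows "coeff ((1 - [:0, -1:] ^ d) ^ c) t =
    (if d dvd t then (-1) ^ (t + t div d) * of_nat (c choose (t div d)) else (0::complex))"
proof -
  have pw: "(- ([:0, -1::complex:] ^ d)) ^ j = monom ((-1) ^ (d * j + j)) (d * j)" for j
  proof -
    have "[:0, -1::complex:] = monom (-1) 1" by (simp add: monom_Suc monom_0)
    then have 1: "- ([:0, -1::complex:] ^ d) = monom (- ((-1) ^ d)) d"
      by (simp add: monom_power minus_monom)
    have 2: "(- ((-1::complex) ^ d)) ^ j = (-1) ^ (d * j + j)"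
      by (simp add: power_add power_mult power_minus[of "(-1) ^ d"] mult.commute)
    show ?thesis unfolding 1 monom_power 2 by (simp add: mult.commute)
  qed
  have "(1 - [:0, -1::complex:] ^ d) ^ c = (\<Sum>j\<le>c. of_nat (c choose j) * monom ((-1) ^ (d * j + j)) (d * j))"
    using binomial_ring[of "- ([:0, -1::complex:] ^ d)" 1 c] by (simp add: pw)
  then have "coeff ((1 - [:0, -1::complex:] ^ d) ^ c) t =
      (\<Sum>j\<le>c. of_nat (c choose j) * (if d * j = t then (-1) ^ (d * j + j) else 0))"
    by (simp add: coeff_sum of_nat_poly)
  also have "\<dots> = (\<Sum>j\<le>c. if j = t div d \<and> d dvd t then of_nat (c choose j) * (-1) ^ (t + j) else 0)"
    using assms by (intro sum.cong) auto
  \<comment> \<open>If \<open>t div d > c\<close>, the index is outside the sum, but then the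
    binomial coefficient is 0 as well.\<close>
  also have "\<dots> = (if d dvd t then (-1) ^ (t + t div d) * of_nat (c choose (t div d)) else 0)"
    by (auto simp: sum.delta mult.commute not_le)
  finally show ?thesis .
qed

section \<open>Periods of subsets of Z/m\<close>

text \<open>Letting \<open>x\<close> range over all integers and reducing modulo \<open>m\<close>
  reads \<open>A\<close> as a set of residues and admits negative and large shifts
  \<open>k\<close>.\<close>

definition is_period :: "nat \<Rightarrow> int set \<Rightarrow> int \<Rightarrow> bool" where
  "is_period m A k \<longleftrightarrow> (\<forall>x. (x + k) mod int m \<in> A \<longleftrightarrow> x mod int m \<in> A)"

definition period :: "nat \<Rightarrow> int set \<Rightarrow> nat" where
  "period m A = (LEAST p. 0 < p \<and> is_period m A (int p))"

lemma is_period_diff: "is_period m A k \<Longrightarrow> is_period m A l \<Longrightarrow> is_period m A (k - l)"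
  unfolding is_period_def by (metis add_diff_eq diff_add_cancel diff_add_eq)

lemma is_period_mult:
  assumes "is_period m A k"
  shows "is_period m A (j * k)"
proof -
  have 0: "is_period m A 0" by (simp add: is_period_def)
  \<comment> \<open>Closure under differences yields the negative multiples first; the positive ones
    follow by subtraction from 0.\<close>
  have neg: "is_period m A (- (int i * k))" for i
  proof (induction i)
    case (Suc i)
    have "- (int (Suc i) * k) = - (int i * k) - k" by (simp add: algebra_simps)
    with is_period_diff[OF Suc assms] show ?case by simp
  qed (simp add: 0)
  have "is_period m A (int i * k)" for i
    using is_period_diff[OF 0 neg[of i]] by simp
  with neg show ?thesis by (cases j rule: int_cases2) auto
qed

lemma is_period_modulus: "is_period m A (int m)"
  by (simp add: is_period_def)

text \<open>The periods form a subgroup of the integers containing \<open>m\<close>; division with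
  remainder shows that its least positive element generates it.\<close>

lemma period:
  assumes "m > 0"
  shows period_pos: "0 < period m A"
    and is_period_iff: "is_period m A k \<longleftrightarrow> int (period m A) dvd k"
    and period_dvd: "period m A dvd m"
proof -
  let ?p = "period m A"
  have "\<exists>p. 0 < p \<and> is_period m A (int p)"
    using assms is_period_modulus by blast
  then have p: "0 < ?p" "is_period m A (int ?p)"
    unfolding period_def by (metis (mono_tags, lifting) LeastI_ex)+
  have least: "?p \<le> q" if "0 < q" "is_period m A (int q)" for q
    unfolding period_def using that by (intro Least_le) simp
  have *: "is_period m A k \<longleftrightarrow> int ?p dvd k" for k
  proof
    assume "is_period m A k"
    then have "is_period m A (k - (k div int ?p) * int ?p)"
      using is_period_diff is_period_mult p(2) by blast
    then have "is_period m A (k mod int ?p)"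
      by (simp add: minus_div_mult_eq_mod)
    moreover have "0 \<le> k mod int ?p" "k mod int ?p < int ?p" using p by auto
    ultimately have "k mod int ?p = 0"
      using least[of "nat (k mod int ?p)"] by (cases "k mod int ?p = 0") auto
    then show "int ?p dvd k" by auto
  next
    assume "int ?p dvd k"
    then show "is_period m A k" using is_period_mult[OF p(2)] by (auto simp: mult.commute elim!: dvdE)
  qed
  show "0 < ?p" "is_period m A k \<longleftrightarrow> int ?p dvd k" by fact+
  show "?p dvd m" using *[of "int m"] is_period_modulus by simp
qed

section \<open>Counting periodic subsets\<close>

text \<open>For \<open>c\<close> dividing \<open>m\<close> this is the preimage of \<open>B\<close>
  under the projection from Z/m to Z/c.\<close>

definition periodic_lift :: "nat \<Rightarrow> nat \<Rightarrow> int set \<Rightarrow> int set" where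
  "periodic_lift m c B = {x \<in> {0..<int m}. x mod int c \<in> B}"

text \<open>Quotient and remainder modulo \<open>c\<close> identify the lift with \<open>d\<close>
  copies of \<open>B\<close>.\<close>

lemma card_periodic_lift:
  assumes "d > 0" "c > 0" "B \<subseteq> {0..<int c}"
  shows "card (periodic_lift (d * c) c B) = d * card B"
proof -
  have "bij_betw (\<lambda>(i, b). b + int c * i) ({0..<int d} \<times> B) (periodic_lift (d * c) c B)"
  proof (rule bij_betwI[where g = "\<lambda>x. (x div int c, x mod int c)"])
    show "(\<lambda>(i, b). b + int c * i) \<in> {0..<int d} \<times> B \<rightarrow> periodic_lift (d * c) c B"
    proof (clarsimp simp: periodic_lift_def)
      fix i b assume i: "0 \<le> i" "i < int d" and b: "b \<in> B"
      then have b': "0 \<le> b" "b < int c" using assms by auto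
      have "b + int c * i < int c * (i + 1)" using b' by (simp add: algebra_simps)
      also have "\<dots> \<le> int c * int d" using i by (intro mult_left_mono) auto
      finally show "0 \<le> b + int c * i \<and> b + int c * i < int d * int c \<and> b mod int c \<in> B"
        using i b b' by (simp add: mult.commute)
    qed
    have "x div int c < int d" if "x < int d * int c" for x
    proof -
      have "x div int c * int c \<le> x"
        using assms by (simp add: minus_mod_eq_div_mult[symmetric])
      with that have "x div int c * int c < int d * int c" by linarith
      then show ?thesis using assms by simp
    qed
    then show "(\<lambda>x. (x div int c, x mod int c)) \<in> periodic_lift (d * c) c B \<rightarrow> {0..<int d} \<times> B"
      using assms by (auto simp: periodic_lift_def pos_imp_zdiv_nonneg_iff)
    show "(\<lambda>x. (x div int c, x mod int c)) ((\<lambda>(i, b). b + int c * i) y) = y"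
      if "y \<in> {0..<int d} \<times> B" for y
      using that assms by (auto simp: subset_iff)
  qed auto
  then have "card (periodic_lift (d * c) c B) = card ({0..<int d} \<times> B)"
    by (simp add: bij_betw_same_card)
  then show ?thesis by (simp add: card_cartesian_product)
qed

lemma is_period_periodic_lift:
  assumes "c > 0" "c dvd m" "m > 0"
  shows "is_period m (periodic_lift m c B) (int c)"
proof -
  have "x mod int m mod int c = x mod int c" for x
    using assms by (intro mod_mod_cancel) auto
  then show ?thesis using assms by (simp add: is_period_def periodic_lift_def)
qed

lemma periodic_lift_restrict:
  assumes "c > 0" "c dvd m" "m > 0" "A \<subseteq> {0..<int m}" "is_period m A (int c)"
  shows "periodic_lift m c (A \<inter> {0..<int c}) = A"
proof -
  have "c \<le> m" using assms by (simp add: dvd_imp_le)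
  have "x mod int c \<in> A \<longleftrightarrow> x \<in> A" if "x \<in> {0..<int m}" for x
  proof -
    \<comment> \<open>A shift by a multiple of \<open>c\<close> carries \<open>x\<close> to its
      remainder modulo \<open>c\<close>, which is already reduced modulo \<open>m\<close> because
      \<open>c \<le> m\<close>.\<close>
    have "is_period m A (- (x div int c) * int c)" using assms(5) by (rule is_period_mult)
    then have "(x + - (x div int c) * int c) mod int m \<in> A \<longleftrightarrow> x mod int m \<in> A"
      unfolding is_period_def by blast
    moreover have "x + - (x div int c) * int c = x mod int c"
      by (simp add: minus_div_mult_eq_mod)
    moreover have "x mod int c mod int m = x mod int c"
      using \<open>c \<le> m\<close> assms(1) by (intro mod_pos_pos_trivial) (auto intro: less_le_trans[OF pos_mod_bound])
    ultimately show ?thesis using that by simp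
  qed
  then show ?thesis using assms by (auto simp: periodic_lift_def)
qed

lemma card_dvd_of_period:
  assumes "d > 0" "c > 0" "A \<subseteq> {0..<int (d * c)}" "is_period (d * c) A (int c)"
  shows "card A = d * card (A \<inter> {0..<int c})"
  using periodic_lift_restrict[of c "d * c" A] card_periodic_lift[of d c "A \<inter> {0..<int c}"] assms
  by simp

text \<open>Lifting from Z/c and restricting to \<open>{0..<int c}\<close> are mutually inverse, and
  lifting multiplies cardinalities by \<open>d\<close>.\<close>

lemma card_periodic_subsets:
  assumes "d > 0" "c > 0"
  shows "card {A. A \<subseteq> {0..<int (d * c)} \<and> card A = t \<and> is_period (d * c) A (int c)} =
    (if d dvd t then c choose (t div d) else 0)"
proof (cases "d dvd t")
  case True
  then obtain u where u: "t = d * u" ..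
  have "bij_betw (periodic_lift (d * c) c) {B. B \<subseteq> {0..<int c} \<and> card B = u}
      {A. A \<subseteq> {0..<int (d * c)} \<and> card A = t \<and> is_period (d * c) A (int c)}"
  proof (rule bij_betwI[where g = "\<lambda>A. A \<inter> {0..<int c}"])
    show "periodic_lift (d * c) c \<in> {B. B \<subseteq> {0..<int c} \<and> card B = u} \<rightarrow>
        {A. A \<subseteq> {0..<int (d * c)} \<and> card A = t \<and> is_period (d * c) A (int c)}"
      using assms card_periodic_lift[of d c] is_period_periodic_lift[of c "d * c"]
      by (auto simp: u) (auto simp: periodic_lift_def)
    show "(\<lambda>A. A \<inter> {0..<int c}) \<in>
        {A. A \<subseteq> {0..<int (d * c)} \<and> card A = t \<and> is_period (d * c) A (int c)} \<rightarrow>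
        {B. B \<subseteq> {0..<int c} \<and> card B = u}"
      using assms card_dvd_of_period[of d c] by (auto simp: u)
    show "periodic_lift (d * c) c B \<inter> {0..<int c} = B"
      if "B \<in> {B. B \<subseteq> {0..<int c} \<and> card B = u}" for B
    proof -
      have "c \<le> d * c" using assms by simp
      then have "int c \<le> int d * int c" by (metis of_nat_le_iff of_nat_mult)
      then have "x < int d * int c" if "x < int c" for x using that by simp
      then show ?thesis using that by (auto simp: periodic_lift_def subset_iff)
    qed
    show "periodic_lift (d * c) c (A \<inter> {0..<int c}) = A"
      if "A \<in> {A. A \<subseteq> {0..<int (d * c)} \<and> card A = t \<and> is_period (d * c) A (int c)}" for A
      using that assms by (intro periodic_lift_restrict) auto
  qed
  then have "card {A. A \<subseteq> {0..<int (d * c)} \<and> card A = t \<and> is_period (d * c) A (int c)} =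
      card {B. B \<subseteq> {0..<int c} \<and> card B = u}"
    by (simp add: bij_betw_same_card)
  also have "\<dots> = c choose u"
    by (simp add: n_subsets)
  finally show ?thesis using assms by (simp add: u)
next
  case False
  then have "{A. A \<subseteq> {0..<int (d * c)} \<and> card A = t \<and> is_period (d * c) A (int c)} = {}"
    using card_dvd_of_period[OF assms] by auto
  then show ?thesis using False by simp
qed

section \<open>Character sums over the subsets of size \<open>t\<close>\<close>

lemma is_period_gcd_iff:
  assumes "m > 0"
  shows "is_period m A (int (gcd k m)) \<longleftrightarrow> is_period m A (int k)"
  using assms period_dvd[OF assms, of A] by (simp add: is_period_iff)

text \<open>The same binomial coefficient occurs twice: up to sign it is the coefficient of the
  generating polynomial, and it counts the subsets with period \<open>k\<close>.\<close>

lemma sum_root_char_subsets: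
  assumes "m > 0"
  shows "(\<Sum>A | A \<subseteq> {0..<int m} \<and> card A = t. root_char m (int k * \<Sum>A)) =
    (-1) ^ (t + t div (m div gcd k m)) *
    of_nat (card {A. A \<subseteq> {0..<int m} \<and> card A = t \<and> is_period m A (int k)})"
proof -
  define c d where "c = gcd k m" and "d = m div c"
  have cd: "c > 0" "d > 0" "m = d * c"
    using assms by (auto simp: c_def d_def div_greater_zero_iff dvd_imp_le)
  define z where "z = root_char m (int k)"
  \<comment> \<open>The order of \<open>z\<close> is exactly \<open>d\<close>, as
    \<open>k div c\<close> is coprime to \<open>d\<close>.\<close>
  have z: "z ^ j = 1 \<longleftrightarrow> d dvd j" for j
  proof -
    have "z ^ j = 1 \<longleftrightarrow> int m dvd int (j * k)"
      using assms by (simp add: z_def root_char_power root_char_eq_1_iff)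
    also have "\<dots> \<longleftrightarrow> m dvd j * k" by (simp only: of_nat_dvd_iff)
    also have "\<dots> \<longleftrightarrow> d dvd j * (k div c)"
    proof -
      have "k = (k div c) * c" by (simp add: c_def)
      then have "m dvd j * k \<longleftrightarrow> d * c dvd j * (k div c) * c"
        by (metis cd(3) mult.assoc)
      then show ?thesis using cd(1) by simp
    qed
    also have "\<dots> \<longleftrightarrow> d dvd j"
    proof -
      have "coprime (k div c) d"
        unfolding c_def d_def by (rule div_gcd_coprime) (use assms in simp)
      then show ?thesis by (simp add: coprime_dvd_mult_left_iff coprime_commute)
    qed
    finally show ?thesis .
  qed
  have "(\<Sum>A | A \<subseteq> {0..<int m} \<and> card A = t. root_char m (int k * \<Sum>A)) =
      (\<Sum>A | A \<subseteq> {0..<int m} \<and> card A = t. \<Prod>a\<in>A. root_char m (int k * a))"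
    by (simp add: sum_distrib_left root_char_sum)
  also have "\<dots> = coeff (\<Prod>a\<in>{0..<int m}. [:1, root_char m (int k * a):]) t"
    by (simp add: coeff_prod_linear)
  also have "(\<Prod>a\<in>{0..<int m}. [:1, root_char m (int k * a):]) = (\<Prod>a<m. [:1, z ^ a:])"
  proof -
    have "{0..<int m} = int ` {..<m}" by (simp add: image_int_atLeastLessThan lessThan_atLeast0)
    then show ?thesis by (simp add: prod.reindex z_def root_char_power mult.commute)
  qed
  \<comment> \<open>The exponents are cut into \<open>c\<close> blocks of length \<open>d\<close>;
    in each block \<open>z ^ a\<close> runs once through all \<open>d\<close>-th roots of
    unity.\<close>
  also have "\<dots> = (\<Prod>i<c. \<Prod>a\<in>{i * d..<i * d + d}. [:1, z ^ a:])"
    by (simp add: prod.nat_group cd(3) mult.commute)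
  also have "\<dots> = (\<Prod>i<c. 1 - [:0, -1:] ^ d)"
  proof (rule prod.cong)
    fix i
    have "(\<Prod>a\<in>{i * d..<i * d + d}. [:1, z ^ a:]) = (\<Prod>a\<in>{0..<d}. [:1, z ^ (a + i * d):])"
      using prod.shift_bounds_nat_ivl[of "\<lambda>a. [:1, z ^ a:]" 0 "i * d" d] by (simp add: add.commute)
    also have "\<dots> = (\<Prod>a<d. [:1, z ^ a:])"
      using z[of "i * d"] by (simp add: power_add lessThan_atLeast0)
    also have "\<dots> = 1 - [:0, -1:] ^ d"
      using cd z by (intro prod_linear_roots_of_unity)
    finally show "(\<Prod>a\<in>{i * d..<i * d + d}. [:1, z ^ a:]) = 1 - [:0, -1:] ^ d" .
  qed simp
  also have "\<dots> = (1 - [:0, -1:] ^ d) ^ c" by simp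
  also have "coeff \<dots> t = (-1) ^ (t + t div d) * of_nat (if d dvd t then c choose (t div d) else 0)"
    using cd by (simp add: coeff_binomial_signed)
  also have "(if d dvd t then c choose (t div d) else 0) =
      card {A. A \<subseteq> {0..<int m} \<and> card A = t \<and> is_period m A (int c)}"
    using card_periodic_subsets[of d c t] cd by simp
  also have "\<dots> = card {A. A \<subseteq> {0..<int m} \<and> card A = t \<and> is_period m A (int k)}"
    using assms by (simp add: c_def is_period_gcd_iff)
  finally show ?thesis by (simp add: c_def d_def)
qed

section \<open>The sign as a shift of the target residue\<close>

text \<open>This is the residue written \<open>\<delta>(e)\<close> in the overview.\<close>

definition shift_residue :: "nat \<Rightarrow> nat \<Rightarrow> nat" where
  "shift_residue t e = (if even e \<and> odd (t div e) then e div 2 else 0)"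

text \<open>With \<open>h = gcd j e\<close> and \<open>u = t div e\<close> the exponent is
  \<open>e * u + h * u\<close>. It is odd exactly when \<open>e\<close> is even and
  \<open>u\<close>, \<open>j\<close> are odd, so the sign is either trivial or
  \<open>(-1) ^ j\<close>; both are characters in \<open>j\<close>.\<close>

lemma sign_eq_root_char:
  assumes "e > 0" "p > 0" "e dvd t"
  shows "(-1) ^ (t + t div (p * e div gcd (p * j) (p * e))) =
    root_char e (int j * int (shift_residue t e))"
proof -
  obtain u where u: "t = e * u" using assms(3) ..
  define h where "h = gcd j e"
  obtain q where q: "e = h * q" unfolding h_def by (metis dvdE gcd_dvd2)
  have hq: "h > 0" "q > 0" using q assms(1) by auto
  have "p * e div gcd (p * j) (p * e) = q"
    using assms hq by (simp add: gcd_mult_left h_def[symmetric]) (simp add: q)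
  then have t: "t div (p * e div gcd (p * j) (p * e)) = h * u"
    using hq by (simp add: u q)
  have ph: "even h \<longleftrightarrow> even j \<and> even e" by (simp add: h_def)
  show ?thesis
  proof (cases "even e \<and> odd u")
    case True
    then obtain f where f: "e = 2 * f" by auto
    have "root_char e (int j * int (shift_residue t e)) = root_char (2 * f) (int f) ^ j"
      using True assms by (simp add: shift_residue_def u f root_char_power)
    also have "\<dots> = (-1) ^ j" using assms f by (simp add: root_char_half)
    also have "\<dots> = (-1) ^ (t + h * u)"
      using True ph by (simp add: u minus_one_power_iff)
    finally show ?thesis by (simp add: t)
  next
    case False
    then have "even (t + h * u)" using ph by (auto simp: u)
    moreover have "shift_residue t e = 0" using False assms by (auto simp: shift_residue_def u)
    ultimately show ?thesis unfolding t by simp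
  qed
qed

section \<open>Stabilisers and Fourier inversion\<close>

text \<open>The stabiliser of \<open>A\<close> in Z/m consists of the multiples of
  \<open>period m A\<close>, whence its order.\<close>

definition stab_order :: "nat \<Rightarrow> int set \<Rightarrow> nat" where
  "stab_order m A = m div period m A"

lemma stab_order_pos: "m > 0 \<Longrightarrow> stab_order m A > 0"
  using period[of m A] by (simp add: stab_order_def div_greater_zero_iff dvd_imp_le)

lemma period_times_stab_order: "m > 0 \<Longrightarrow> period m A * stab_order m A = m"
  using period[of m A] by (simp add: stab_order_def)

lemma stab_order_dvd_card:
  assumes "m > 0" "A \<subseteq> {0..<int m}"
  shows "stab_order m A dvd card A"
proof -
  have "is_period m A (int (period m A))" using assms by (simp add: is_period_iff)
  then show ?thesis
    using card_dvd_of_period[of "stab_order m A" "period m A" A] assms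
      period_times_stab_order[of m A] stab_order_pos[of m A] period_pos[of m A]
    by (simp add: mult.commute)
qed

text \<open>Only multiples \<open>k = p * j\<close> of the period contribute. On them the sign is a
  character of Z/e, so orthogonality modulo \<open>e\<close> evaluates the sum.\<close>

lemma sum_over_periods:
  assumes "m > 0" "A \<subseteq> {0..<int m}" "card A = t"
  shows "(\<Sum>k<m. if is_period m A (int k)
      then root_char m (- int k * n) * (-1) ^ (t + t div (m div gcd k m)) else 0) =
    (if int (stab_order m A) dvd int (shift_residue t (stab_order m A)) - n
     then of_nat (stab_order m A) else 0)"
proof -
  define p e where "p = period m A" and "e = stab_order m A"
  have pe: "p > 0" "e > 0" "m = p * e" "e dvd t"
    using assms period_pos[of m A] stab_order_pos[of m A] period_times_stab_order[of m A]
      stab_order_dvd_card[of m A] by (auto simp: p_def e_def)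
  have per: "is_period m A (int k) \<longleftrightarrow> p dvd k" for k
    using assms by (simp add: is_period_iff p_def)
  let ?f = "\<lambda>k. root_char m (- int k * n) * (-1) ^ (t + t div (m div gcd k m))"
  have "(\<Sum>k<m. if is_period m A (int k) then ?f k else 0) = (\<Sum>k | k < m \<and> p dvd k. ?f k)"
    by (intro sum.mono_neutral_cong_right) (auto simp: per)
  also have "\<dots> = (\<Sum>j<e. ?f (p * j))"
    by (rule sum.reindex_bij_witness[where i = "\<lambda>j. p * j" and j = "\<lambda>k. k div p"])
      (use pe in \<open>auto simp: div_less_iff_less_mult mult.commute\<close>)
  also have "\<dots> = (\<Sum>j<e. root_char e (int j * (int (shift_residue t e) - n)))"
  proof (rule sum.cong)
    fix j
    have "root_char m (- int (p * j) * n) = root_char e (- int j * n)"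
      using root_char_cancel[of p e "- int j * n"] pe by (simp add: mult.assoc)
    then have "?f (p * j) = root_char e (- int j * n) * root_char e (int j * int (shift_residue t e))"
      using sign_eq_root_char[of e p t j] pe by simp
    also have "\<dots> = root_char e (int j * (int (shift_residue t e) - n))"
      by (simp add: algebra_simps flip: root_char_add)
    finally show "?f (p * j) = root_char e (int j * (int (shift_residue t e) - n))" .
  qed simp
  finally show ?thesis by (simp only: sum_root_char[OF pe(2)] flip: e_def)
qed

lemma Q_eq_sum_stab_order:
  assumes "m > 0"
  shows "m * Q m t n = (\<Sum>A | A \<subseteq> {0..<int m} \<and> card A = t.
    if int (stab_order m A) dvd int (shift_residue t (stab_order m A)) - n then stab_order m A else 0)"
proof -
  define T where "T = {A. A \<subseteq> {0..<int m} \<and> card A = t}"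
  have fin: "finite T" unfolding T_def by (rule finite_subset[of _ "Pow {0..<int m}"]) auto
  have "Q m t n = card {A \<in> T. int m dvd \<Sum>A - n}"
    by (simp add: Q_def T_def cong_iff_dvd_diff)
  then have "complex_of_nat (m * Q m t n) = (\<Sum>A\<in>T. if int m dvd \<Sum>A - n then of_nat m else 0)"
    using fin by (simp add: sum.If_cases Int_def mult.commute)
  \<comment> \<open>Orthogonality detects the congruence between the subset sum and
    \<open>n\<close>.\<close>
  also have "\<dots> = (\<Sum>A\<in>T. \<Sum>k<m. root_char m (int k * (\<Sum>A - n)))"
    using assms by (simp add: sum_root_char)
  also have "\<dots> = (\<Sum>k<m. \<Sum>A\<in>T. root_char m (- int k * n) * root_char m (int k * \<Sum>A))"
    by (subst sum.swap) (simp add: algebra_simps flip: root_char_add)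
  also have "\<dots> = (\<Sum>k<m. root_char m (- int k * n) * (-1) ^ (t + t div (m div gcd k m)) *
      of_nat (card {A \<in> T. is_period m A (int k)}))"
    using sum_root_char_subsets[OF assms, where t = t]
    by (simp add: sum_distrib_left[symmetric] T_def conj_assoc mult.assoc)
  \<comment> \<open>The count is written out as a sum of indicators, so that the sum over
    \<open>k\<close> can move inside again.\<close>
  also have "\<dots> = (\<Sum>k<m. \<Sum>A\<in>T. if is_period m A (int k)
      then root_char m (- int k * n) * (-1) ^ (t + t div (m div gcd k m)) else 0)"
    using fin by (simp add: sum.If_cases Int_def mult.commute)
  also have "\<dots> = (\<Sum>A\<in>T. \<Sum>k<m. if is_period m A (int k)
      then root_char m (- int k * n) * (-1) ^ (t + t div (m div gcd k m)) else 0)"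
    by (rule sum.swap)
  also have "\<dots> = (\<Sum>A\<in>T. if int (stab_order m A) dvd int (shift_residue t (stab_order m A)) - n
     then of_nat (stab_order m A) else 0)"
    using assms by (intro sum.cong sum_over_periods) (auto simp: T_def)
  also have "\<dots> = complex_of_nat (\<Sum>A\<in>T.
      if int (stab_order m A) dvd int (shift_residue t (stab_order m A)) - n then stab_order m A else 0)"
    by (simp add: if_distrib cong: if_cong)
  finally show ?thesis unfolding T_def of_nat_eq_iff .
qed

section \<open>Where the maximum is attained\<close>

text \<open>Makes the congruence for \<open>g\<close> imply the one for each divisor
  \<open>e\<close>. Write \<open>g = e * x\<close>. For odd \<open>x\<close> the two residues are
  both zero or both halves, and \<open>g/2 - e/2 = e * (x - 1)/2\<close>; for even \<open>x\<close>
  the residue for \<open>e\<close> is 0 and that for \<open>g\<close> is 0 or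
  \<open>e * (x/2)\<close>.\<close>

lemma dvd_shift_residue_diff:
  assumes "g > 0" "e dvd g" "g dvd t"
  shows "int e dvd int (shift_residue t g) - int (shift_residue t e)"
proof -
  obtain x where x: "g = e * x" using assms(2) ..
  obtain y where y: "t = g * y" using assms(3) ..
  have "e > 0" "x > 0" using x assms(1) by auto
  then have g: "t div g = y" and e: "t div e = x * y" using assms by (auto simp: x y)
  consider "even e" "odd x" | "even x" | "odd e" "odd x" by blast
  then show ?thesis
  proof cases
    case 1
    then obtain h w where "e = 2 * h" "x = 2 * w + 1" by (auto elim!: evenE oddE)
    then show ?thesis unfolding shift_residue_def g e by (auto simp: x algebra_simps)
  next
    case 2
    then obtain w where "x = 2 * w" by auto
    then show ?thesis unfolding shift_residue_def g e by (auto simp: x)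
  next
    case 3
    then show ?thesis unfolding shift_residue_def g e by (simp add: x)
  qed
qed

text \<open>Any subset of size \<open>t\<close> with period \<open>m div g\<close> works: its
  stabiliser order is a multiple of \<open>g\<close>, and it divides both \<open>t\<close> and
  \<open>m\<close>.\<close>

lemma exists_stab_order_gcd:
  assumes "m > 0" "t \<le> m"
  shows "\<exists>A \<subseteq> {0..<int m}. card A = t \<and> stab_order m A = gcd t m"
proof -
  define g c where "g = gcd t m" and "c = m div g"
  have g: "g > 0" "g dvd t" "g dvd m" "m = g * c" using assms by (auto simp: g_def c_def)
  then have c: "c > 0" using assms by (cases c) auto
  have "t div g \<le> c" using assms by (simp add: c_def div_le_mono)
  then have "card {A. A \<subseteq> {0..<int (g * c)} \<and> card A = t \<and> is_period (g * c) A (int c)} > 0"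
    using g c by (simp add: card_periodic_subsets del: of_nat_mult)
  then obtain A where A: "A \<subseteq> {0..<int m}" "card A = t" "is_period m A (int c)"
    unfolding g(4)[symmetric] by (metis (mono_tags, lifting) card_gt_0_iff empty_Collect_eq)
  have "period m A dvd c" using A(3) assms by (simp add: is_period_iff)
  then obtain q where "c = period m A * q" ..
  then have "period m A * stab_order m A = period m A * (g * q)"
    using period_times_stab_order[OF assms(1), of A] g(4) by (simp add: mult_ac)
  then have "g dvd stab_order m A" using period_pos[OF assms(1), of A] by simp
  moreover have "stab_order m A dvd g"
    using stab_order_dvd_card[OF assms(1) A(1)] A(2) period_times_stab_order[OF assms(1), of A]
    unfolding g_def by (metis dvd_triv_right gcd_greatest)
  ultimately show ?thesis using A dvd_antisym unfolding g_def by blast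
qed

text \<open>Each \<open>A\<close> contributes at most \<open>stab_order m A\<close> to
  \<open>m * Q m t n\<close>. The congruence modulo \<open>g\<close> makes all these bounds
  equalities; if it fails, a subset with stabiliser order \<open>g\<close> contributes 0.\<close>

lemma Q_maximal_iff:
  assumes "m > 0" "t \<le> m"
  shows "(\<forall>k. Q m t k \<le> Q m t n) \<longleftrightarrow> int (gcd t m) dvd int (shift_residue t (gcd t m)) - n"
proof -
  define g where "g = gcd t m"
  define T where "T = {A. A \<subseteq> {0..<int m} \<and> card A = t}"
  have fin: "finite T" unfolding T_def by (rule finite_subset[of _ "Pow {0..<int m}"]) auto
  define w where "w = (\<lambda>k A. if int (stab_order m A) dvd int (shift_residue t (stab_order m A)) - k
    then stab_order m A else 0)"
  have Q: "m * Q m t k = sum (w k) T" for k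
    using Q_eq_sum_stab_order[OF assms(1)] by (simp add: T_def w_def)
  have g: "g > 0" "g dvd t" using assms by (auto simp: g_def)
  have le: "w k A \<le> stab_order m A" for k A by (simp add: w_def)
  have full: "sum (w k) T = sum (stab_order m) T" if "int g dvd int (shift_residue t g) - k" for k
  proof (rule sum.cong)
    fix A assume "A \<in> T"
    then have e: "stab_order m A dvd g"
      using stab_order_dvd_card[OF assms(1), of A] period_times_stab_order[OF assms(1), of A]
      unfolding g_def T_def by (metis (mono_tags, lifting) dvd_triv_right gcd_greatest mem_Collect_eq)
    then have "int (stab_order m A) dvd int (shift_residue t g) - k"
      using that by (meson dvd_trans of_nat_dvd_iff)
    from dvd_diff[OF this dvd_shift_residue_diff[OF g(1) e g(2)]]
    show "w k A = stab_order m A" by (simp add: w_def)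
  qed simp
  show ?thesis
  proof
    assume max: "\<forall>k. Q m t k \<le> Q m t n"
    show "int (gcd t m) dvd int (shift_residue t (gcd t m)) - n"
    proof (rule ccontr)
      assume contra: "\<not> ?thesis"
      obtain A where A: "A \<in> T" "stab_order m A = g"
        using exists_stab_order_gcd[OF assms] by (auto simp: T_def g_def)
      have "w n A < stab_order m A"
        using contra g(1) unfolding w_def A(2) by (simp flip: g_def)
      with A(1) fin le have "sum (w n) T < sum (stab_order m) T"
        by (intro sum_strict_mono_ex1) blast+
      also have "\<dots> = m * Q m t (int (shift_residue t g))"
        using full[of "int (shift_residue t g)"] by (simp add: Q)
      finally have "Q m t n < Q m t (int (shift_residue t g))"
        by (simp flip: Q)
      with max show False by (metis not_less)
    qed
  next
    assume "int (gcd t m) dvd int (shift_residue t (gcd t m)) - n"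
    then have "m * Q m t k \<le> m * Q m t n" for k
      unfolding Q using full[of n] by (simp add: g_def le sum_mono)
    then show "\<forall>k. Q m t k \<le> Q m t n" using assms by simp
  qed
qed

section \<open>Translation into valuations and greatest common divisors\<close>

lemma v2_eq_iff_odd_div:
  assumes "g > 0" "g dvd t"
  shows "v2 g = v2 t \<longleftrightarrow> odd (t div g)"
    and "v2 g < v2 t \<longleftrightarrow> even (t div g)"
proof -
  obtain y where y: "t = g * y" using assms(2) ..
  have *: "(v2 g = v2 t \<longleftrightarrow> odd y) \<and> (v2 g < v2 t \<longleftrightarrow> even y)"
  \<comment> \<open>Here \<open>t = 0\<close>: its valuation is infinite, that of \<open>g\<close>
    is finite, and the quotient 0 is even.\<close>
  proof (cases "y = 0")
    case True
    then show ?thesis using assms(1) by (simp add: v2_def y)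
  next
    case False
    have "multiplicity 2 t = multiplicity 2 g + multiplicity 2 y"
      unfolding y using assms(1) False by (intro prime_elem_multiplicity_mult_distrib) auto
    moreover have "multiplicity 2 y = 0 \<longleftrightarrow> odd y"
      using False by (intro multiplicity_eq_zero_iff) auto
    moreover have "t \<noteq> 0" using False assms(1) y by simp
    ultimately show ?thesis using assms(1) by (auto simp: v2_def)
  qed
  from * show "v2 g = v2 t \<longleftrightarrow> odd (t div g)" "v2 g < v2 t \<longleftrightarrow> even (t div g)"
    using assms(1) by (simp_all add: y)
qed

text \<open>Both sides say that \<open>n\<close> is an odd multiple of \<open>h\<close>.\<close>

lemma gcd_double_eq_half_iff:
  fixes h n :: int
  assumes "h > 0"
  shows "gcd n (2 * h) = h \<longleftrightarrow> 2 * h dvd h - n"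
proof
  assume gcd: "gcd n (2 * h) = h"
  then obtain q where q: "n = h * q" by (metis dvdE gcd_dvd1)
  have "odd q"
  proof
    assume "even q"
    then have "2 * h dvd gcd n (2 * h)" by (auto simp: q)
    then have "2 * h dvd h" by (simp only: gcd)
    then show False using assms zdvd_imp_le[of "2 * h" h] by simp
  qed
  then obtain r where "q = 2 * r + 1" ..
  then have "h - n = 2 * h * (- r)" by (simp add: q algebra_simps)
  then show "2 * h dvd h - n" by (metis dvd_triv_left)
next
  assume "2 * h dvd h - n"
  then obtain r where "h - n = 2 * h * r" ..
  then have n: "n = h * (1 - 2 * r)" by (simp add: algebra_simps)
  have "coprime (1 - 2 * r) 2" by simp
  then show "gcd n (2 * h) = h"
    using assms gcd_mult_left[of h "1 - 2 * r" 2] by (simp add: n mult.commute)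
qed

theorem theorem2:
  fixes m t g :: nat and n :: int
  assumes "m > 0" and "t \<le> m" and "g = gcd t m"
  shows "(\<forall>k. Q m t k \<le> Q m t n) \<longleftrightarrow>
      (odd g \<and> gcd n (gcd (int t) (int m)) = int g) \<or>
      (even g \<and> v2 g < v2 t \<and> gcd n (gcd (int t) (int m)) = int g) \<or>
      (even g \<and> v2 g = v2 t \<and> gcd n (gcd (int t) (int m)) = int (g div 2))"
proof -
  have g: "g > 0" "g dvd t" "gcd (int t) (int m) = int g"
    using assms by simp_all
  have gcd: "gcd n (int g) = int g \<longleftrightarrow> int g dvd n"
    by (metis abs_of_nat gcd.commute gcd_dvd2 gcd_proj1_if_dvd_int)
  have max: "(\<forall>k. Q m t k \<le> Q m t n) \<longleftrightarrow> int g dvd int (shift_residue t g) - n"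
    using Q_maximal_iff[OF assms(1,2)] assms(3) by simp
  show ?thesis
  proof (cases "even g \<and> odd (t div g)")
    case True
    then obtain h where h: "g = 2 * h" by auto
    have "shift_residue t g = h" using True h by (simp add: shift_residue_def)
    then have "(\<forall>k. Q m t k \<le> Q m t n) \<longleftrightarrow> gcd n (int g) = int (g div 2)"
      using gcd_double_eq_half_iff[of "int h" n] g(1) h by (simp add: max)
    moreover have "v2 g = v2 t" using True g by (simp add: v2_eq_iff_odd_div)
    ultimately show ?thesis using True unfolding g(3) by simp
  next
    case False
    then have "shift_residue t g = 0" by (auto simp: shift_residue_def)
    then have "(\<forall>k. Q m t k \<le> Q m t n) \<longleftrightarrow> gcd n (int g) = int g"
      by (simp add: max gcd)
    \<comment> \<open>For odd \<open>g\<close> the valuations may agree, but the third alternative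
      still fails by parity.\<close>
    moreover have "odd g \<or> v2 g < v2 t \<and> v2 g \<noteq> v2 t"
      using False g by (auto simp: v2_eq_iff_odd_div)
    ultimately show ?thesis unfolding g(3) by auto
  qed
qed

end
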